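(* Let $(s_n)_{n\ge 1}$ be the increasing enumeration of $S=\{2^j3^k : j,k\in\mathbb{Z}_{\ge 0}\}$, and let $W(S)$ be the set of $x\in\mathbb{T}=\mathbb{R}/\mathbb{Z}$ such that the sequence $(s_nx)_{n\ge 1}$ is not equidistributed modulo $1$. Then $W(S)$ has Hausdorff dimension $\ge 0.451621$, and there exists a Rajchman probability measure $\mu$ on $\mathbb{T}$ supported by $W(S)$, i.e. with $\mu(W(S))=1$.
   Context: A finite measure $\mu$ on $\mathbb{T}$ is called a Rajchman measure if its Fourier coefficients $\widehat\mu(n)=\int_{\mathbb{T}}e^{-2\pi i nx}\,d\mu(x)$ tend to $0$ as $|n|\to\infty$. A sequence $(s_nx)$ is equidistributed modulo 1 if $\frac1N\sum_{n=1}^N e^{2\pi i h s_n x}\to 0$ as $N\to\infty$ for every $h\in\mathbb{Z}\setminus\{0\}$. *)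

theory Defs
  imports "HOL-Probability.Probability"
begin

section \<open>The circle group \<open>\<real>/\<int>\<close>\<close>

quotient_type circle = real / "\<lambda>x y :: real. x - y \<in> \<int>"
proof (rule equivpI)
  show "reflp (\<lambda>x y :: real. x - y \<in> \<int>)"
    by (simp add: reflp_def)
  show "symp (\<lambda>x y :: real. x - y \<in> \<int>)"
    unfolding symp_def by (metis Ints_minus minus_diff_eq)
  show "transp (\<lambda>x y :: real. x - y \<in> \<int>)"
    unfolding transp_def by (metis Ints_add diff_add_cancel add_diff_eq)
qed

text \<open>
  The metric is the quotient metric: the distance from \<open>x - y\<close> to the nearest integer.
\<close>

instantiation circle :: metric_space
begin

lift_definition dist_circle :: "circle \<Rightarrow> circle \<Rightarrow> real"
  is "\<lambda>x y. \<bar>(x - y) - of_int (round (x - y))\<bar>"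
proof -
  fix x x' y y' :: real
  assume "x - x' \<in> \<int>" "y - y' \<in> \<int>"
  then obtain a b where "x = x' + of_int a" "y = y' + of_int b"
    by (metis Ints_cases diff_add_cancel add.commute)
  then have *: "x - y = (x' - y') + of_int (a - b)"
    by simp
  have "round (x - y) = round (x' - y') + (a - b)"
    unfolding * round_def by linarith
  with * show "\<bar>x - y - of_int (round (x - y))\<bar> = \<bar>x' - y' - of_int (round (x' - y'))\<bar>"
    by simp
qed

definition uniformity_circle :: "(circle \<times> circle) filter"
  where "uniformity_circle = (INF e\<in>{0 <..}. principal {(x, y). dist x y < e})"

definition open_circle :: "circle set \<Rightarrow> bool"
  where "open_circle U \<longleftrightarrow> (\<forall>x\<in>U. eventually (\<lambda>(x', y). x' = x \<longrightarrow> y \<in> U) uniformity)"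

instance
proof
  fix x y z :: circle
  show "dist x y = 0 \<longleftrightarrow> x = y"
  proof transfer
    fix x y :: real
    show "\<bar>x - y - of_int (round (x - y))\<bar> = 0 \<longleftrightarrow> x - y \<in> \<int>"
      by (auto elim: Ints_cases) (metis Ints_of_int)
  qed
  show "dist x y \<le> dist x z + dist y z"
  proof transfer
    fix x y z :: real
    have "\<bar>x - y - of_int (round (x - y))\<bar>
        \<le> \<bar>x - y - of_int (round (x - z) - round (y - z))\<bar>"
      by (rule round_diff_minimal)
    then show "\<bar>x - y - of_int (round (x - y))\<bar>
        \<le> \<bar>x - z - of_int (round (x - z))\<bar> + \<bar>y - z - of_int (round (y - z))\<bar>"
      by simp
  qed
qed (simp_all add: uniformity_circle_def open_circle_def)

end

lift_definition circle_mult :: "nat \<Rightarrow> circle \<Rightarrow> circle"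
  is "\<lambda>m x. of_nat m * x"
  by (metis Ints_mult Ints_of_nat right_diff_distrib)

text \<open>The character \<open>x \<mapsto> exp (2\<pi>inx)\<close>.\<close>

lift_definition circle_char :: "int \<Rightarrow> circle \<Rightarrow> complex"
  is "\<lambda>n x. exp (2 * complex_of_real pi * \<i> * of_int n * complex_of_real x)"
proof -
  fix n :: int and x y :: real
  assume "x - y \<in> \<int>"
  then obtain k where "x = y + of_int k"
    by (metis Ints_cases diff_add_cancel add.commute)
  then have "2 * complex_of_real pi * \<i> * of_int n * complex_of_real x
      = 2 * complex_of_real pi * \<i> * of_int n * complex_of_real y
        + (2 * of_int (n * k) * complex_of_real pi) * \<i>"
    by (simp add: algebra_simps)
  then show "exp (2 * complex_of_real pi * \<i> * of_int n * complex_of_real x)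
      = exp (2 * complex_of_real pi * \<i> * of_int n * complex_of_real y)"
    unfolding exp_eq by (intro exI[of _ "n * k"]) simp
qed


section \<open>Equidistribution\<close>

text \<open>Sequences are indexed from 1; the value at 0 plays no role.\<close>

definition equidistributed :: "(nat \<Rightarrow> circle) \<Rightarrow> bool" where
  "equidistributed y \<longleftrightarrow>
     (\<forall>h::int. h \<noteq> 0 \<longrightarrow>
        (\<lambda>N. (1 / of_nat N) * (\<Sum>n=1..N. circle_char h (y n))) \<longlonglongrightarrow> 0)"

text \<open>
  The increasing enumeration \<open>s\<^sub>1 < s\<^sub>2 < \<dots>\<close> of an infinite set of naturals
  (\<^const>\<open>enumerate\<close> counts from 0).
\<close>

definition increasing_enum :: "nat set \<Rightarrow> nat \<Rightarrow> nat" where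
  "increasing_enum S n = enumerate S (n - 1)"

definition W :: "nat set \<Rightarrow> circle set" where
  "W S = {x. \<not> equidistributed (\<lambda>n. circle_mult (increasing_enum S n) x)}"


section \<open>Hausdorff dimension\<close>

text \<open>
  The \<open>s\<close>-th power of the diameter, with the conventions that the empty set contributes 0
  and that \<open>diam U ^ 0 = 1\<close> for nonempty \<open>U\<close> (whereas \<open>0 powr 0 = 0\<close>).
\<close>

definition diameter_powr :: "real \<Rightarrow> 'a::metric_space set \<Rightarrow> ennreal" where
  "diameter_powr s U =
     (if U = {} then 0 else if s = 0 then 1 else ennreal (diameter U powr s))"

text \<open>Boundedness is required because \<^const>\<open>diameter\<close> is unspecified on unbounded sets.\<close>

definition hausdorff_premeasure :: "real \<Rightarrow> real \<Rightarrow> 'a::metric_space set \<Rightarrow> ennreal" where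
  "hausdorff_premeasure s \<delta> A =
     (INF U \<in> {U :: nat \<Rightarrow> 'a set. A \<subseteq> (\<Union>i. U i) \<and> (\<forall>i. bounded (U i) \<and> diameter (U i) \<le> \<delta>)}.
        \<Sum>i. diameter_powr s (U i))"

definition hausdorff_measure :: "real \<Rightarrow> 'a::metric_space set \<Rightarrow> ennreal" where
  "hausdorff_measure s A = (SUP \<delta>\<in>{0<..}. hausdorff_premeasure s \<delta> A)"

definition hausdorff_dim :: "'a::metric_space set \<Rightarrow> ereal" where
  "hausdorff_dim A = (INF s \<in> {s. 0 \<le> s \<and> hausdorff_measure s A = 0}. ereal s)"


section \<open>Rajchman measures\<close>

definition fourier_coeff :: "circle measure \<Rightarrow> int \<Rightarrow> complex" where
  "fourier_coeff \<mu> n = (LINT x|\<mu>. circle_char (- n) x)"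

definition rajchman_measure :: "circle measure \<Rightarrow> bool" where
  "rajchman_measure \<mu> \<longleftrightarrow>
     finite_measure \<mu> \<and> sets \<mu> = sets borel \<and>
     (fourier_coeff \<mu> \<longlongrightarrow> 0) (filtercomap abs at_top)"

end

theory Submission
  imports Defs
begin

text \<open>
  If the binary digits of \<open>x\<close> at the positions \<open>4q \<le> j < 5q\<close> vanish, then \<open>x\<close> lies within \<open>2\<^sup>-\<^sup>5\<^sup>q\<close> of a
  fraction with denominator \<open>2\<^sup>4\<^sup>q\<close>, so \<open>2\<^sup>j3\<^sup>kx\<close> is close to an integer whenever \<open>j \<ge> 4q\<close> and
  \<open>2\<^sup>j3\<^sup>k\<close> is somewhat smaller than \<open>2\<^sup>5\<^sup>q\<close>. These pairs make up a positive proportion of all \<open>(j, k)\<close>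
  with \<open>2\<^sup>j3\<^sup>k < 2\<^sup>5\<^sup>q\<close>. Testing with the Fejer-type kernel \<open>\<bar>\<Sum>h<H. exp (2\<pi>iht)\<bar>\<^sup>2\<close>, of mean \<open>H\<close> but of size
  \<open>H\<^sup>2\<close> near 0, shows that \<open>x \<in> W S\<close> if this happens for infinitely many \<open>q\<close>.

  With \<open>q = 4\<^sup>l\<close>, erasing the digits of all these blocks leaves at least half of the first \<open>n\<close> digits
  free for every \<open>n\<close>, and choosing the free digits by coin tosses gives a measure for the mass
  distribution principle: the dimension is at least \<open>1/2\<close>.

  For the Rajchman measure, the erased blocks are chosen at random, infinitely many of them but so
  that the probability of erasing a particular block \<open>l\<close> tends to 0. If \<open>\<bar>n\<bar>\<close> is about \<open>2\<^sup>b\<close>, the factors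
  of the \<open>n\<close>-th Fourier coefficient coming from the digits just before position \<open>b\<close> telescope to a
  small quantity as long as these digits are free, and only one block can interfere with them.
\<close>

abbreviation e :: "real \<Rightarrow> complex" where "e t \<equiv> cis (2 * pi * t)"

lemma circle_char_abs: "circle_char n (abs_circle x) = e (of_int n * x)"
  by (simp add: circle_char.abs_eq cis_conv_exp mult_ac)

lemma circle_mult_abs: "circle_mult m (abs_circle x) = abs_circle (of_nat m * x)"
  by (simp add: circle_mult.abs_eq)

lemma dist_abs_circle: "dist (abs_circle x) (abs_circle y) = \<bar>(x - y) - of_int (round (x - y))\<bar>"
  by (simp add: dist_circle.abs_eq)

lemma circle_char_0 [simp]: "circle_char 0 y = 1"
  by transfer simp

section \<open>Binary digits\<close>

text \<open>Most significant digit first, so \<open>val n d / 2 ^ n\<close> is the truncation of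
  \<open>bin d\<close> to \<open>n\<close> digits.\<close>

fun val :: "nat \<Rightarrow> (nat \<Rightarrow> bool) \<Rightarrow> nat" where
  "val 0 d = 0"
| "val (Suc n) d = 2 * val n d + of_bool (d n)"

definition bin :: "(nat \<Rightarrow> bool) \<Rightarrow> real" where
  "bin d = (\<Sum>j. of_bool (d j) / 2 ^ Suc j)"

lemma bin_partial_sum: "(\<Sum>j<n. of_bool (d j) / 2 ^ Suc j :: real) = val n d / 2 ^ n"
  by (induction n) (auto simp: field_simps)

lemma bin_summable: "summable (\<lambda>j. of_bool (d j) / 2 ^ Suc j :: real)"
proof (rule summable_comparison_test')
  show "summable (\<lambda>j. (1/2) ^ Suc j :: real)"
    by (simp only: summable_Suc_iff) (simp add: summable_geometric)
  show "norm (of_bool (d j) / 2 ^ Suc j :: real) \<le> (1/2) ^ Suc j" if "0 \<le> j" for j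
    by (simp add: field_simps)
qed

lemma bin_lower: "val n d / 2 ^ n \<le> bin d"
  unfolding bin_def bin_partial_sum[symmetric]
  by (rule sum_le_suminf[OF bin_summable]) auto

text \<open>The right endpoints of the dyadic intervals decrease as \<open>n\<close> grows and
  dominate all later partial sums. Equality occurs when all later digits are 1.\<close>

lemma bin_upper: "bin d \<le> (val n d + 1) / 2 ^ n"
proof -
  have shift: "(val n d + 1) / 2 ^ n \<le> (val m d + 1) / (2 ^ m :: real)" if "m \<le> n" for m n
    using that
  proof (induction n rule: dec_induct)
    case (step k)
    have "(val (Suc k) d + 1) / 2 ^ Suc k \<le> (val k d + 1) / (2 ^ k :: real)"
      by (auto simp: field_simps)
    with step show ?case by linarith
  qed simp
  have "(\<lambda>N. \<Sum>j<N. of_bool (d j) / 2 ^ Suc j) \<longlonglongrightarrow> bin d"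
    unfolding bin_def by (rule summable_LIMSEQ[OF bin_summable])
  then show ?thesis
  proof (rule LIMSEQ_le_const2, intro exI allI impI)
    fix N assume "n \<le> N"
    have "(\<Sum>j<N. of_bool (d j) / 2 ^ Suc j) \<le> (val N d + 1) / (2 ^ N :: real)"
      by (simp only: bin_partial_sum) (simp add: field_simps)
    also have "\<dots> \<le> (val n d + 1) / 2 ^ n" by (rule shift) fact
    finally show "(\<Sum>j<N. of_bool (d j) / 2 ^ Suc j) \<le> (val n d + 1) / (2 ^ n :: real)" .
  qed
qed

lemma val_zero_digits:
  assumes "\<And>j. m \<le> j \<Longrightarrow> j < m + k \<Longrightarrow> \<not> d j"
  shows "val (m + k) d = 2 ^ k * val m d"
  using assms by (induction k) auto

text \<open>Digit \<open>j\<close> has weight \<open>2 ^ -(j + 1)\<close>, so the digits before block \<open>l\<close> make up a fraction with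
  denominator \<open>2 ^ (4 * 4 ^ l)\<close>.\<close>

definition block :: "nat \<Rightarrow> nat set" where
  "block l = {4 * 4 ^ l ..< 5 * 4 ^ l}"

lemma bin_zero_block:
  assumes "\<And>j. j \<in> block l \<Longrightarrow> \<not> d j"
  obtains a :: nat and t where "bin d = a / 2 ^ (4 * 4 ^ l) + t" "0 \<le> t" "t \<le> 1 / 2 ^ (5 * 4 ^ l)"
proof -
  have eq: "5 * 4 ^ l = 4 * 4 ^ l + (4 ^ l :: nat)" by simp
  have v: "val (5 * 4 ^ l) d = 2 ^ 4 ^ l * val (4 * 4 ^ l) d"
    unfolding eq using assms by (intro val_zero_digits) (auto simp: block_def)
  then have v': "val (5 * 4 ^ l) d / 2 ^ (5 * 4 ^ l) = val (4 * 4 ^ l) d / (2 ^ (4 * 4 ^ l) :: real)"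
    unfolding eq power_add by simp
  show ?thesis
  proof (rule that)
    show "bin d = real (val (4 * 4 ^ l) d) / 2 ^ (4 * 4 ^ l) + (bin d - val (5 * 4 ^ l) d / 2 ^ (5 * 4 ^ l))"
      using v' by simp
    show "0 \<le> bin d - val (5 * 4 ^ l) d / 2 ^ (5 * 4 ^ l)"
      using bin_lower[where n = "5 * 4 ^ l" and d = d] by simp
    show "bin d - val (5 * 4 ^ l) d / 2 ^ (5 * 4 ^ l) \<le> 1 / 2 ^ (5 * 4 ^ l)"
      using bin_upper[where n = "5 * 4 ^ l" and d = d] by (simp add: add_divide_distrib)
  qed
qed

section \<open>Zero blocks prevent equidistribution\<close>

lemma sum_char_square:
  "(\<Sum>h<H. \<Sum>k<H. circle_char (int h - int k) y) = of_real ((norm (\<Sum>h<H. circle_char (int h) y))\<^sup>2)"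
proof (induction y rule: circle.abs_induct)
  case (1 x)
  have "e ((real h - real k) * x) = e (h * x) * cnj (e (k * x))" for h k :: nat
    by (simp add: cis_cnj cis_mult algebra_simps)
  then show ?case
    by (simp add: circle_char_abs complex_norm_square sum_product del: of_real_power)
qed

text \<open>Expand the square by \<open>sum_char_square\<close>: equidistribution removes every
  character with \<open>h\<close> distinct from \<open>k\<close>, and the \<open>H\<close> diagonal
  terms each average to 1.\<close>

lemma equidistributed_avg_kernel:
  assumes "equidistributed y"
  shows "(\<lambda>N. (\<Sum>n=1..N. (norm (\<Sum>h<H. circle_char (int h) (y n)))\<^sup>2) / N) \<longlonglongrightarrow> real H"
proof -
  have "(\<lambda>N. 1 / of_nat N * (\<Sum>n=1..N. circle_char (int h - int k) (y n))) \<longlonglongrightarrow> of_bool (h = k)"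
    for h k
  proof (cases "h = k")
    case True
    have "\<forall>\<^sub>F N in sequentially. 1 / of_nat N * (\<Sum>n=1..N. circle_char (int h - int k) (y n)) = 1"
      using eventually_gt_at_top[of 0] by eventually_elim (use True in simp)
    with True show ?thesis by (simp add: tendsto_eventually)
  next
    case False
    with assms show ?thesis by (simp add: equidistributed_def)
  qed
  then have "(\<lambda>N. \<Sum>h<H. \<Sum>k<H. 1 / of_nat N * (\<Sum>n=1..N. circle_char (int h - int k) (y n)))
      \<longlonglongrightarrow> (\<Sum>h<H. \<Sum>k<H. of_bool (h = k))"
    by (intro tendsto_sum)
  also have "(\<Sum>h<H. \<Sum>k<H. of_bool (h = k) :: complex) = of_nat H"
    by simp
  also have "(\<lambda>N. \<Sum>h<H. \<Sum>k<H. 1 / of_nat N * (\<Sum>n=1..N. circle_char (int h - int k) (y n)))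
     = (\<lambda>N. of_real ((\<Sum>n=1..N. (norm (\<Sum>h<H. circle_char (int h) (y n)))\<^sup>2) / N))"
  proof
    fix N
    have "(\<Sum>h<H. \<Sum>k<H. 1 / of_nat N * (\<Sum>n=1..N. circle_char (int h - int k) (y n)))
      = 1 / of_nat N * (\<Sum>h<H. \<Sum>k<H. \<Sum>n=1..N. circle_char (int h - int k) (y n))"
      by (simp add: sum_distrib_left)
    also have "(\<Sum>h<H. \<Sum>k<H. \<Sum>n=1..N. circle_char (int h - int k) (y n))
      = (\<Sum>h<H. \<Sum>n=1..N. \<Sum>k<H. circle_char (int h - int k) (y n))"
      by (intro sum.cong refl sum.swap)
    also have "\<dots> = (\<Sum>n=1..N. \<Sum>h<H. \<Sum>k<H. circle_char (int h - int k) (y n))"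
      by (rule sum.swap)
    finally show "(\<Sum>h<H. \<Sum>k<H. 1 / of_nat N * (\<Sum>n=1..N. circle_char (int h - int k) (y n)))
      = of_real ((\<Sum>n=1..N. (norm (\<Sum>h<H. circle_char (int h) (y n)))\<^sup>2) / N)"
      by (simp add: sum_char_square)
  qed
  finally have "(\<lambda>N. of_real ((\<Sum>n=1..N. (norm (\<Sum>h<H. circle_char (int h) (y n)))\<^sup>2) / N) :: complex)
      \<longlonglongrightarrow> of_real (real H)" by simp
  then show ?thesis by (simp only: tendsto_of_real_iff)
qed

text \<open>All angles \<open>2 * pi * h * t\<close> with \<open>h < H\<close> are at most
  \<open>pi / 3\<close>, so every term has real part at least 1/2 and no cancellation
  occurs.\<close>

lemma kernel_near_0:
  assumes "x = of_int a + t" "0 \<le> t" "real H * t \<le> 1/6"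
  shows "(norm (\<Sum>h<H. circle_char (int h) (abs_circle x)))\<^sup>2 \<ge> (real H)\<^sup>2 / 4"
proof -
  have "Re (circle_char (int h) (abs_circle x)) \<ge> 1/2" if "h < H" for h
  proof -
    have "abs_circle x = abs_circle t"
      using assms(1) by (simp add: circle.abs_eq_iff)
    then have "Re (circle_char (int h) (abs_circle x)) = cos (2 * pi * (h * t))"
      by (simp add: circle_char_abs)
    moreover have "real h * t \<le> real H * t"
      using that assms(2) by (intro mult_right_mono) auto
    then have "h * t \<le> 1/6" using assms(3) by linarith
    then have "cos (2 * pi * (h * t)) \<ge> cos (2 * pi * (1/6))"
      using assms(2) by (intro cos_monotone_0_pi_le mult_left_mono) auto
    moreover have "cos (2 * pi * (1/6)) = 1/2" using cos_60 by simp
    ultimately show ?thesis by simp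
  qed
  then have "(\<Sum>h<H. 1/2) \<le> Re (\<Sum>h<H. circle_char (int h) (abs_circle x))"
    unfolding Re_sum by (intro sum_mono) auto
  then have "real H / 2 \<le> norm (\<Sum>h<H. circle_char (int h) (abs_circle x))"
    using complex_Re_le_cmod[of "\<Sum>h<H. circle_char (int h) (abs_circle x)"] by simp
  then have "(real H / 2)\<^sup>2 \<le> (norm (\<Sum>h<H. circle_char (int h) (abs_circle x)))\<^sup>2"
    by (intro power_mono) auto
  then show ?thesis by (simp add: power_divide)
qed

section \<open>Counting elements of \<open>S\<close>\<close>

text \<open>Turns averages along the enumeration into sums over an initial segment of
  \<open>S\<close>. Here \<open>N\<close> is the index of \<open>X\<close> under
  \<open>enumerate\<close>, which counts from 0, so \<open>X\<close> itself is left out.\<close>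

lemma sum_increasing_enum:
  assumes "infinite S" "X \<in> S"
  obtains N where "N = card {s\<in>S. s < X}"
    "\<And>g :: nat \<Rightarrow> real. (\<Sum>n=1..N. g (increasing_enum S n)) = (\<Sum>s\<in>{s\<in>S. s < X}. g s)"
proof -
  obtain N where N: "enumerate S N = X"
    using enumerate_Ex assms by blast
  have mono: "strict_mono (enumerate S)"
    using assms(1) by (rule strict_mono_enumerate)
  have img: "enumerate S ` {..<N} = {s\<in>S. s < X}"
  proof safe
    fix n assume "n < N"
    show "enumerate S n \<in> S" by (simp add: enumerate_in_set assms(1))
    show "enumerate S n < X" unfolding N[symmetric]
      using \<open>n < N\<close> mono by (simp add: strict_mono_less)
  next
    fix s assume "s \<in> S" "s < X"
    then obtain n where "s = enumerate S n" using enumerate_Ex assms(1) by blast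
    with \<open>s < X\<close> N mono show "s \<in> enumerate S ` {..<N}"
      by (auto simp: strict_mono_less)
  qed
  have inj: "inj_on (enumerate S) {..<N}"
    using mono by (meson inj_on_subset strict_mono_imp_inj_on subset_UNIV)
  show ?thesis
  proof (rule that)
    show "N = card {s\<in>S. s < X}"
      unfolding img[symmetric] by (simp add: card_image inj)
    show "(\<Sum>n=1..N. g (increasing_enum S n)) = (\<Sum>s\<in>{s\<in>S. s < X}. g s)" for g :: "nat \<Rightarrow> real"
      unfolding img[symmetric] sum.reindex[OF inj] increasing_enum_def
      by (intro sum.reindex_bij_witness[of _ Suc "\<lambda>n. n - 1"]) auto
  qed
qed

text \<open>Cancelling the smaller power of 2 would leave an even number equal to a power of 3.
  Counting pairs of exponents therefore counts elements of \<open>S\<close>.\<close>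

lemma pow2_pow3_inj: "inj (\<lambda>(j, k). 2 ^ j * 3 ^ k :: nat)"
proof -
  have *: "j \<ge> j'" if "2 ^ j * 3 ^ k = (2 ^ j' * 3 ^ k' :: nat)" for j k j' k'
  proof (rule ccontr)
    assume "\<not> j \<ge> j'"
    then obtain i where "j' = Suc (j + i)" using less_imp_Suc_add not_le by metis
    with that have "3 ^ k = (2 * 2 ^ i * 3 ^ k' :: nat)" by (simp add: power_add)
    then have "even (3 ^ k :: nat)" by simp
    then show False by simp
  qed
  show ?thesis
  proof (rule injI, clarify)
    fix j k j' k' :: nat
    assume eq: "2 ^ j * 3 ^ k = (2 ^ j' * 3 ^ k' :: nat)"
    then have "j = j'" using * by (metis order_antisym)
    with eq show "j = j' \<and> k = k'" by simp
  qed
qed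

lemma not_equidistributed_zero_blocks:
  fixes S :: "nat set"
  assumes S: "S = {2 ^ j * 3 ^ k | j k :: nat. True}"
    and inf: "infinite L"
    and zero: "\<And>l j. l \<in> L \<Longrightarrow> j \<in> block l \<Longrightarrow> \<not> d j"
  shows "abs_circle (bin d) \<in> W S"
proof (rule ccontr)
  let ?x = "abs_circle (bin d)"
  \<comment> \<open>At least a proportion 1/400 of the points will lie near 0, where the kernel is
    at least \<open>H ^ 2 / 4\<close>. The average is then at least
    \<open>H ^ 2 / 1600 = 2500\<close>, above the limit \<open>H\<close>.\<close>
  define H :: nat where "H = 2000"
  define K where "K y = (norm (\<Sum>h<H. circle_char (int h) y))\<^sup>2" for y
  assume "?x \<notin> W S"
  then have "equidistributed (\<lambda>n. circle_mult (increasing_enum S n) ?x)"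
    by (simp add: W_def)
  from equidistributed_avg_kernel[OF this, of H]
  have "(\<lambda>N. (\<Sum>n=1..N. K (circle_mult (increasing_enum S n) ?x)) / N) \<longlonglongrightarrow> real H"
    by (simp add: K_def)
  then have "\<forall>\<^sub>F N in sequentially. (\<Sum>n=1..N. K (circle_mult (increasing_enum S n) ?x)) / N < 2500"
    by (rule order_tendstoD) (simp add: H_def)
  then obtain N0 where N0:
      "\<And>N. N \<ge> N0 \<Longrightarrow> (\<Sum>n=1..N. K (circle_mult (increasing_enum S n) ?x)) / N < 2500"
    by (auto simp: eventually_sequentially)
  \<comment> \<open>\<open>l > N0\<close> ensures \<open>N >= N0\<close> below, because
    \<open>N >= u ^ 2 >= u >= l\<close>; \<open>l > 3\<close> makes \<open>u\<close> large enough
    for the comparison of exponents.\<close>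
  obtain l where l: "l \<in> L" "l > max N0 3"
    using inf by (meson infinite_nat_iff_unbounded)
  \<comment> \<open>In terms of \<open>u\<close>, block \<open>l\<close> runs from
    \<open>16 * u\<close> to \<open>20 * u\<close>.\<close>
  define u :: nat where "u = 4 ^ (l - 1)"
  have u4: "4 ^ l = 4 * u" unfolding u_def using l by (cases l) auto
  have lu: "l \<le> u"
  proof -
    have "l - 1 < 2 ^ (l - 1)" by (rule less_exp)
    also have "2 ^ (l - 1) \<le> u" unfolding u_def by (intro power_mono) auto
    finally show ?thesis by simp
  qed
  have "4 ^ 2 \<le> u" unfolding u_def using l(2) by (intro power_increasing) auto
  then have u16: "u \<ge> 16" by simp
  obtain a :: nat and t where t: "bin d = a / 2 ^ (16 * u) + t" "0 \<le> t" "t \<le> 1 / 2 ^ (20 * u)"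
    using bin_zero_block[of l d] zero[OF l(1)] unfolding u4 by auto
  \<comment> \<open>The 14 leaves room for the kernel: \<open>s < X\<close> gives
    \<open>s * t <= 1 / 2 ^ 14\<close>, and \<open>2000 / 2 ^ 14 < 1/6\<close>.\<close>
  define X :: nat where "X = 2 ^ (20 * u - 14)"
  have "X \<in> S" unfolding S X_def by (intro CollectI exI[of _ "20 * u - 14"] exI[of _ 0]) simp
  moreover have "infinite S"
  proof (rule infinite_super)
    show "range (\<lambda>j. 2 ^ j :: nat) \<subseteq> S"
      unfolding S by (force intro: exI[of _ 0])
    show "infinite (range (\<lambda>j. 2 ^ j :: nat))"
      by (intro range_inj_infinite injI) simp
  qed
  ultimately obtain N where N: "N = card {s\<in>S. s < X}"
    and sum_N: "\<And>g :: nat \<Rightarrow> real. (\<Sum>n=1..N. g (increasing_enum S n)) = (\<Sum>s\<in>{s\<in>S. s < X}. g s)"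
    using sum_increasing_enum[of S X] by blast
  let ?f = "\<lambda>(j, k). 2 ^ j * 3 ^ k :: nat"
  have upper: "{s\<in>S. s < X} \<subseteq> ?f ` ({..<20 * u} \<times> {..<20 * u})"
  proof safe
    fix s assume "s \<in> S" "s < X"
    then obtain j k where s: "s = 2 ^ j * 3 ^ k" using S by blast
    have "X \<le> 2 ^ (20 * u)" unfolding X_def by (intro power_increasing) auto
    moreover have "2 ^ j \<le> s" "3 ^ k \<le> s" unfolding s by auto
    moreover have "2 ^ k \<le> (3 ^ k :: nat)" by (intro power_mono) auto
    ultimately have "2 ^ j < (2 ^ (20 * u) :: nat)" "2 ^ k < (2 ^ (20 * u) :: nat)"
      using \<open>s < X\<close> by linarith+
    then have "j < 20 * u" "k < 20 * u" by auto
    then show "s \<in> ?f ` ({..<20 * u} \<times> {..<20 * u})" using s by auto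
  qed
  have N_le: "N \<le> 400 * u\<^sup>2"
  proof -
    have "N \<le> card (?f ` ({..<20 * u} \<times> {..<20 * u}))"
      unfolding N using upper by (intro card_mono) auto
    also have "\<dots> \<le> card ({..<20 * u} \<times> {..<20 * u})" by (intro card_image_le) auto
    finally show ?thesis by (simp add: power2_eq_square)
  qed
  \<comment> \<open>A factor \<open>2 ^ j\<close> with \<open>j >= 16 * u\<close> clears the
    denominator of the rational part of \<open>bin d\<close>. The upper bounds on \<open>j\<close>
    and \<open>k\<close> keep the products below \<open>X\<close>, since
    \<open>3 ^ k <= 2 ^ (2 * k)\<close>.\<close>
  define A where "A = ?f ` ({16 * u ..< 17 * u} \<times> {..<u})"
  have cardA: "card A = u\<^sup>2"
    unfolding A_def by (subst card_image) (auto intro: inj_on_subset[OF pow2_pow3_inj] simp: power2_eq_square)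
  have A: "A \<subseteq> {s\<in>S. s < X}"
  proof
    fix s assume "s \<in> A"
    then obtain j k where s: "s = 2 ^ j * 3 ^ k" "16 * u \<le> j" "j < 17 * u" "k < u"
      by (auto simp: A_def)
    have "s \<le> 2 ^ j * 4 ^ k" unfolding s by (intro mult_left_mono power_mono) auto
    also have "\<dots> = 2 ^ (j + 2 * k)" by (simp add: power_add power_mult)
    also have "\<dots> < X" unfolding X_def using s u16 by (intro power_strict_increasing) auto
    finally show "s \<in> {s\<in>S. s < X}" using s S by auto
  qed
  have K_A: "K (circle_mult s ?x) \<ge> 2000\<^sup>2 / 4" if "s \<in> A" for s
  proof -
    from that obtain j k where s: "s = 2 ^ j * 3 ^ k" "16 * u \<le> j"
      by (auto simp: A_def)
    then obtain i where i: "j = 16 * u + i" using le_Suc_ex by blast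
    have x: "real s * bin d = of_int (2 ^ i * 3 ^ k * a) + s * t"
      by (simp add: t(1) s i power_add field_simps)
    have "s * t \<le> X * (1 / 2 ^ (20 * u))"
      using A that t by (intro mult_mono) auto
    also have "X * (1 / 2 ^ (20 * u)) = (1 / 2 ^ 14 :: real)"
    proof -
      have "20 * u = 14 + (20 * u - 14)" using u16 by simp
      then have "(2::real) ^ (20 * u) = 2 ^ 14 * X" unfolding X_def by (metis of_nat_numeral of_nat_power power_add)
      then show ?thesis unfolding X_def by simp
    qed
    finally have "real H * (s * t) \<le> 1/6" by (simp add: H_def)
    from kernel_near_0[OF x _ this] t(2) show ?thesis
      unfolding K_def circle_mult_abs by (simp add: H_def)
  qed
  have fin: "finite {s\<in>S. s < X}" by simp
  have "real (u\<^sup>2) * (2000\<^sup>2 / 4) = (\<Sum>s\<in>A. 2000\<^sup>2 / 4)"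
    by (simp only: sum_constant cardA)
  also have "\<dots> \<le> (\<Sum>s\<in>A. K (circle_mult s ?x))" by (intro sum_mono K_A)
  also have "\<dots> \<le> (\<Sum>s\<in>{s\<in>S. s < X}. K (circle_mult s ?x))"
    using A fin by (intro sum_mono2) (auto simp: K_def)
  also have "\<dots> = (\<Sum>n=1..N. K (circle_mult (increasing_enum S n) ?x))"
    by (rule sum_N[symmetric])
  finally have le: "real (u\<^sup>2) * (2000\<^sup>2 / 4) \<le> (\<Sum>n=1..N. K (circle_mult (increasing_enum S n) ?x))" .
  have "u\<^sup>2 \<le> N" unfolding N cardA[symmetric] using A fin by (intro card_mono)
  moreover have "u \<le> u\<^sup>2" by (simp add: power2_eq_square)
  ultimately have "N0 \<le> N" "N > 0" using l(2) lu by auto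
  from N0[OF this(1)] this(2) have "(\<Sum>n=1..N. K (circle_mult (increasing_enum S n) ?x)) < 2500 * real N"
    by (simp add: field_simps)
  also have "\<dots> \<le> 2500 * real (400 * u\<^sup>2)"
    using N_le by (intro mult_left_mono of_nat_mono) auto
  finally show False using le by simp
qed

section \<open>Hausdorff dimension\<close>

lemma borel_measurable_val:
  assumes [measurable]: "\<And>j. Measurable.pred M (\<lambda>\<omega>. D \<omega> j)"
  shows "(\<lambda>\<omega>. real (val n (D \<omega>))) \<in> borel_measurable M"
  by (induction n) (auto intro!: borel_measurable_add borel_measurable_times)

lemma borel_measurable_bin:
  assumes [measurable]: "\<And>j. Measurable.pred M (\<lambda>\<omega>. D \<omega> j)"
  shows "(\<lambda>\<omega>. bin (D \<omega>)) \<in> borel_measurable M"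
  unfolding bin_def of_bool_def by measurable

lemma pred_val:
  assumes "\<And>j. Measurable.pred M (\<lambda>\<omega>. D \<omega> j)"
  shows "Measurable.pred M (\<lambda>\<omega>. val n (D \<omega>) = k)"
proof -
  have [measurable]: "(\<lambda>\<omega>. real (val n (D \<omega>))) \<in> borel_measurable M"
    using assms by (rule borel_measurable_val)
  have "Measurable.pred M (\<lambda>\<omega>. real (val n (D \<omega>)) = real k)" by measurable
  then show ?thesis by simp
qed

lemma val_less: "val n d < 2 ^ n"
  by (induction n) auto

text \<open>The parity of \<open>val n d\<close> recovers the last digit; induction recovers the
  others.\<close>

lemma val_inj:
  assumes "val n d = val n d'" "j < n"
  shows "d j = d' j"
  using assms
proof (induction n)
  case (Suc n)
  have "d n = d' n"
    using arg_cong[OF Suc.prems(1), of even] by (auto split: if_splits)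
  moreover from this have "val n d = val n d'" using Suc.prems(1) by simp
  ultimately show ?case using Suc by (cases "j = n") auto
qed simp

section \<open>Digits chosen by coin tosses\<close>

abbreviation coin :: "bool measure" where
  "coin \<equiv> measure_pmf (pmf_of_set UNIV)"

definition coins :: "(nat \<Rightarrow> bool) measure" where
  "coins = PiM UNIV (\<lambda>_. coin)"

interpretation coin_product: product_prob_space "\<lambda>_ :: nat. coin" UNIV
  by unfold_locales

interpretation coins: prob_space coins
  unfolding coins_def by (rule coin_product.P.prob_space_axioms)

lemma space_coins [simp]: "space coins = UNIV"
  by (simp add: coins_def space_PiM)

lemma prob_coins_UNIV [simp]: "measure coins UNIV = 1"
  using coins.prob_space by simp

lemma pred_coins [measurable]: "Measurable.pred coins (\<lambda>b. b j)"
proof -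
  have "(\<lambda>b. b j) \<in> measurable coins coin"
    unfolding coins_def by (rule measurable_component_singleton) simp
  then show ?thesis by (simp add: measurable_def pred_def)
qed

lemma prob_coins_agree:
  assumes "finite F"
  shows "measure coins {b. \<forall>j\<in>F. b j = c j} = (1/2) ^ card F"
proof -
  have "emeasure coins {b. \<forall>j\<in>F. b j = c j} = (\<Prod>j\<in>F. emeasure coin {c j})"
    using coin_product.emeasure_PiM_Collect[of F "\<lambda>j. {c j}"] assms
    by (simp add: coins_def space_PiM)
  also have "\<dots> = (\<Prod>j\<in>F. ennreal (1/2))"
    by (simp add: emeasure_pmf_single)
  also have "\<dots> = ennreal ((1/2) ^ card F)"
    by (subst prod_constant, subst ennreal_power) auto
  finally show ?thesis
    by (simp add: measure_def)
qed

definition mask :: "nat set \<Rightarrow> (nat \<Rightarrow> bool) \<Rightarrow> nat \<Rightarrow> bool" where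
  "mask Z b = (\<lambda>j. b j \<and> j \<notin> Z)"

lemma pred_mask [measurable]: "Measurable.pred coins (\<lambda>b. mask Z b j)"
  unfolding mask_def by measurable

text \<open>If some \<open>c\<close> attains the value \<open>k\<close>, every \<open>b\<close>
  attaining it agrees with \<open>c\<close> at all unerased positions below \<open>n\<close>;
  otherwise the event is empty.\<close>

lemma prob_val_mask: "measure coins {b. val n (mask Z b) = k} \<le> (1/2) ^ card ({..<n} - Z)"
proof (cases "\<exists>c. val n (mask Z c) = k")
  case True
  then obtain c where c: "val n (mask Z c) = k" by blast
  have "measure coins {b. val n (mask Z b) = k} \<le> measure coins {b. \<forall>j\<in>{..<n} - Z. b j = c j}"
  proof (rule coins.finite_measure_mono)
    show "{b. val n (mask Z b) = k} \<subseteq> {b. \<forall>j\<in>{..<n} - Z. b j = c j}"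
      using val_inj[of n _ "mask Z c"] c by (fastforce simp: mask_def)
    have "Measurable.pred coins (\<lambda>b. \<forall>j\<in>{..<n} - Z. b j = c j)" by measurable
    then show "{b. \<forall>j\<in>{..<n} - Z. b j = c j} \<in> sets coins" by (simp add: pred_def)
  qed
  then show ?thesis by (simp add: prob_coins_agree)
qed simp

lemma continuous_abs_circle: "continuous_on UNIV abs_circle"
proof (rule continuous_onI)
  fix x and \<epsilon> :: real assume "\<epsilon> > 0"
  moreover have "dist (abs_circle y) (abs_circle x) \<le> dist y x" for y
    using round_diff_minimal[of "y - x" 0] by (simp add: dist_abs_circle dist_real_def)
  ultimately show "\<exists>d>0. \<forall>y\<in>UNIV. dist y x < d \<longrightarrow> dist (abs_circle y) (abs_circle x) \<le> \<epsilon>"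
    by (meson less_eq_real_def order_trans)
qed

lemma measurable_abs_circle [measurable]: "abs_circle \<in> borel \<rightarrow>\<^sub>M borel"
  using continuous_abs_circle by (rule borel_measurable_continuous_onI)

text \<open>Closeness to \<open>y\<close> leaves at most 12 possible values for the first
  \<open>n\<close> digits, and \<open>prob_val_mask\<close> bounds the probability of each.\<close>

lemma prob_bin_mask_near:
  "measure coins {b. dist (abs_circle (bin (mask Z b))) y \<le> 1 / 2 ^ n} \<le> 12 * (1/2) ^ card ({..<n} - Z)"
proof (induction y rule: circle.abs_induct)
  case (1 u0)
  define u where "u = frac u0"
  have u: "0 \<le> u" "u < 1"
    by (simp_all add: u_def frac_lt_1)
  have abs_u: "abs_circle u0 = abs_circle u"
    by (simp add: u_def circle.abs_eq_iff frac_def)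
  \<comment> \<open>\<open>z\<close> is the integer shift in the distance modulo 1, with three
    possible values; \<open>i\<close> runs over the four integers allowed by truncation and by the
    radius.\<close>
  define K where "K = (\<lambda>(z :: int, i). nat (\<lfloor>2 ^ n * (u + of_int z)\<rfloor> + i)) ` ({-1..1} \<times> {-2..1})"
  have finK: "finite K" unfolding K_def by simp
  have "card K \<le> card ({-1..1 :: int} \<times> {-2..1 :: int})" unfolding K_def by (rule card_image_le) simp
  then have cardK: "card K \<le> 12" by simp
  have meas: "{b. val n (mask Z b) = k} \<in> coins.events" for k
    using pred_val[where M = coins and D = "mask Z" and n = n and k = k, OF pred_mask] by (simp add: pred_def)
  have sub: "{b. dist (abs_circle (bin (mask Z b))) (abs_circle u0) \<le> 1 / 2 ^ n} \<subseteq> (\<Union>k\<in>K. {b. val n (mask Z b) = k})"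
  proof
    fix b assume "b \<in> {b. dist (abs_circle (bin (mask Z b))) (abs_circle u0) \<le> 1 / 2 ^ n}"
    define x where "x = bin (mask Z b)"
    define v where "v = val n (mask Z b)"
    define z where "z = round (x - u)"
    have d: "\<bar>x - u - z\<bar> \<le> 1 / 2 ^ n"
      using \<open>b \<in> _\<close> by (simp add: abs_u dist_abs_circle x_def z_def)
    have x: "0 \<le> x" "x \<le> 1"
      using bin_lower[of 0 "mask Z b"] bin_upper[of "mask Z b" 0] by (simp_all add: x_def)
    then have "-1 \<le> z" "z \<le> 1"
      unfolding z_def round_def using u by linarith+
    have "v / 2 ^ n \<le> x" "x \<le> (v + 1) / 2 ^ n"
      unfolding v_def x_def by (rule bin_lower, rule bin_upper)
    then have "(real v - 1) / 2 ^ n \<le> u + z" "u + z \<le> (real v + 2) / 2 ^ n"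
      using d by (simp_all add: add_divide_distrib diff_divide_distrib abs_le_iff)
    then have "real v \<le> 2 ^ n * (u + z) + 1" "2 ^ n * (u + z) - 2 \<le> v"
      by (simp_all add: divide_le_eq le_divide_eq mult.commute)
    then have "\<lfloor>2 ^ n * (u + z)\<rfloor> - 2 \<le> int v" "int v \<le> \<lfloor>2 ^ n * (u + z)\<rfloor> + 1"
      by linarith+
    then have "v = nat (\<lfloor>2 ^ n * (u + z)\<rfloor> + (v - \<lfloor>2 ^ n * (u + z)\<rfloor>))"
      "v - \<lfloor>2 ^ n * (u + z)\<rfloor> \<in> {-2..1}"
      by auto
    with \<open>-1 \<le> z\<close> \<open>z \<le> 1\<close> have "v \<in> K"
      unfolding K_def by (intro image_eqI[of _ _ "(z, v - \<lfloor>2 ^ n * (u + z)\<rfloor>)"]) auto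
    then show "b \<in> (\<Union>k\<in>K. {b. val n (mask Z b) = k})" by (simp add: v_def)
  qed
  have "measure coins {b. dist (abs_circle (bin (mask Z b))) (abs_circle u0) \<le> 1 / 2 ^ n}
      \<le> measure coins (\<Union>k\<in>K. {b. val n (mask Z b) = k})"
    using sub meas finK by (intro coins.finite_measure_mono) auto
  also have "\<dots> \<le> (\<Sum>k\<in>K. measure coins {b. val n (mask Z b) = k})"
    using finK meas by (intro coins.finite_measure_subadditive_finite) auto
  also have "\<dots> \<le> (\<Sum>k\<in>K. (1/2) ^ card ({..<n} - Z))"
    by (intro sum_mono prob_val_mask)
  also have "\<dots> \<le> 12 * (1/2) ^ card ({..<n} - Z)"
    using cardK by simp
  finally show ?case .
qed

section \<open>Mass distribution principle and the dimension bound\<close>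

text \<open>For \<open>s < t\<close>, each set of a fine cover carries mass at most a constant times
  its diameter to the power \<open>s\<close>. The total mass 1 then bounds the covering sum away
  from 0.\<close>

lemma hausdorff_dim_mass_distribution:
  fixes X :: "'b \<Rightarrow> 'a :: metric_space"
  assumes "prob_space M"
    and X: "\<And>\<omega>. \<omega> \<in> space M \<Longrightarrow> X \<omega> \<in> A"
    and meas: "\<And>y r. {\<omega>\<in>space M. dist (X \<omega>) y \<le> r} \<in> sets M"
    and bound: "\<And>y r. 0 < r \<Longrightarrow> r \<le> 1 \<Longrightarrow> measure M {\<omega>\<in>space M. dist (X \<omega>) y \<le> r} \<le> C * r powr t"
    and "0 < t"
  shows "ereal t \<le> hausdorff_dim A"
  unfolding hausdorff_dim_def
proof (rule INF_greatest, safe)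
  interpret prob_space M by fact
  fix s :: real
  assume s: "0 \<le> s" "hausdorff_measure s A = 0"
  show "ereal t \<le> ereal s"
  proof (rule ccontr)
    assume "\<not> ereal t \<le> ereal s"
    then have "s < t" by simp
    \<comment> \<open>The maximum with 1 covers \<open>s = 0\<close>, where the trivial bound 1 is
      used, and makes \<open>C'\<close> positive for the later division.\<close>
    define C' where "C' = max C 1"
    have ball_le: "measure M {\<omega>\<in>space M. dist (X \<omega>) y \<le> diameter U} \<le> C' * (if s = 0 then 1 else diameter U powr s)"
      if U: "U \<noteq> {}" "bounded U" "diameter U \<le> 1" for U :: "'a set" and y
    proof (cases "s = 0")
      case True
      then show ?thesis using prob_le_1[of "{\<omega>\<in>space M. dist (X \<omega>) y \<le> diameter U}"] unfolding C'_def
        by (simp add: le_max_iff_disj)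
    next
      case False
      show ?thesis
      proof (cases "diameter U = 0")
        case True
        \<comment> \<open>\<open>bound\<close> speaks of positive radii only, so the mass at radius
          0 is shown to vanish by letting \<open>r\<close> tend to 0.\<close>
        have "((\<lambda>r. C * r powr t) \<longlongrightarrow> C * 0 powr t) (at_right 0)"
          using \<open>0 < t\<close> by (intro tendsto_intros) (auto simp: eventually_at_right_less eventually_at_filter)
        moreover have "\<forall>\<^sub>F r in at_right 0. measure M {\<omega>\<in>space M. dist (X \<omega>) y \<le> diameter U} \<le> C * r powr t"
          using eventually_at_right_less[of 0] eventually_at_right_real[of 0 1, simplified]
        proof eventually_elim
          case (elim r)
          have "measure M {\<omega>\<in>space M. dist (X \<omega>) y \<le> diameter U} \<le> measure M {\<omega>\<in>space M. dist (X \<omega>) y \<le> r}"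
            using elim True by (intro finite_measure_mono meas) auto
          also have "\<dots> \<le> C * r powr t" using elim by (intro bound) auto
          finally show ?case .
        qed
        ultimately have "measure M {\<omega>\<in>space M. dist (X \<omega>) y \<le> diameter U} \<le> C * 0 powr t"
          by (rule tendsto_lowerbound) simp
        then show ?thesis using True \<open>s \<noteq> 0\<close> by simp
      next
        case False
        then have pos: "0 < diameter U" using diameter_ge_0[OF U(2)] by linarith
        have "measure M {\<omega>\<in>space M. dist (X \<omega>) y \<le> diameter U} \<le> C * diameter U powr t"
          using pos U(3) by (rule bound)
        also have "\<dots> \<le> C' * diameter U powr s"
          using \<open>s < t\<close> U(3) pos by (intro mult_mono powr_mono') (auto simp: C'_def)
        finally show ?thesis using \<open>s \<noteq> 0\<close> by simp
      qed
    qed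
    \<comment> \<open>The Hausdorff measure is a supremum over scales, so a positive lower bound at
      scale 1 contradicts its vanishing.\<close>
    have "ennreal (1 / C') \<le> hausdorff_premeasure s 1 A"
      unfolding hausdorff_premeasure_def
    proof (rule INF_greatest, safe)
      fix U :: "nat \<Rightarrow> 'a set"
      assume cover: "A \<subseteq> (\<Union>i. U i)" and U: "\<forall>i. bounded (U i) \<and> diameter (U i) \<le> 1"
      \<comment> \<open>A nonempty set lies in the closed ball about any of its points with its
        diameter as radius. For an empty set \<open>SOME\<close> would give an arbitrary centre,
        hence the case split.\<close>
      define E where "E i = (if U i = {} then {} else {\<omega>\<in>space M. dist (X \<omega>) (SOME y. y \<in> U i) \<le> diameter (U i)})" for i
      have E_sets: "E i \<in> sets M" for i unfolding E_def using meas by simp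
      have "space M \<subseteq> (\<Union>i. E i)"
      proof
        fix \<omega> assume "\<omega> \<in> space M"
        then obtain i where i: "X \<omega> \<in> U i" using X cover by blast
        then have "(SOME y. y \<in> U i) \<in> U i" by (rule someI)
        then have "dist (X \<omega>) (SOME y. y \<in> U i) \<le> diameter (U i)"
          using i U by (intro diameter_bounded_bound) auto
        with i \<open>\<omega> \<in> space M\<close> show "\<omega> \<in> (\<Union>i. E i)" by (auto simp: E_def intro!: exI[of _ i])
      qed
      then have "1 \<le> emeasure M (\<Union>i. E i)"
        unfolding emeasure_space_1[symmetric] using E_sets by (intro emeasure_mono) auto
      also have "\<dots> \<le> (\<Sum>i. emeasure M (E i))"
        using E_sets by (intro emeasure_subadditive_countably) auto
      also have "\<dots> \<le> (\<Sum>i. ennreal C' * diameter_powr s (U i))"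
      proof (intro suminf_le summableI)
        fix i
        show "emeasure M (E i) \<le> ennreal C' * diameter_powr s (U i)"
        proof (cases "U i = {}")
          case False
          then have E: "E i = {\<omega>\<in>space M. dist (X \<omega>) (SOME y. y \<in> U i) \<le> diameter (U i)}"
            by (simp add: E_def)
          have "measure M (E i) \<le> C' * (if s = 0 then 1 else diameter (U i) powr s)"
            unfolding E using False U by (intro ball_le) auto
          then have "emeasure M (E i) \<le> ennreal (C' * (if s = 0 then 1 else diameter (U i) powr s))"
            unfolding emeasure_eq_measure by (rule ennreal_leI)
          with False show ?thesis
            by (auto simp: diameter_powr_def ennreal_mult C'_def)
        qed (simp add: E_def)
      qed
      also have "\<dots> = ennreal C' * (\<Sum>i. diameter_powr s (U i))"
        by (rule ennreal_suminf_cmult)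
      finally have "ennreal (1 / C') * 1 \<le> ennreal (1 / C') * (ennreal C' * (\<Sum>i. diameter_powr s (U i)))"
        by (rule mult_left_mono) simp
      moreover have "ennreal (1 / C') * ennreal C' = 1"
        by (simp add: C'_def flip: ennreal_mult)
      ultimately show "ennreal (1 / C') \<le> (\<Sum>i. diameter_powr s (U i))"
        by (simp add: mult.assoc[symmetric])
    qed
    also have "\<dots> \<le> hausdorff_measure s A"
      unfolding hausdorff_measure_def by (rule SUP_upper) simp
    finally show False using s(2) by (simp add: C'_def)
  qed
qed

text \<open>For the least \<open>L\<close> with \<open>n <= 4 * 4 ^ L\<close>, only blocks below
  \<open>L\<close> meet the first \<open>n\<close> positions. Their lengths sum to less than
  \<open>4 ^ L / 3\<close>, while \<open>n > 4 ^ L\<close> unless \<open>L = 0\<close>.\<close>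

lemma card_outside_blocks: "n \<le> 2 * card ({..<n} - (\<Union>l. block l))"
proof -
  obtain L where L: "n \<le> 4 * 4 ^ L" "\<And>i. i < L \<Longrightarrow> \<not> n \<le> 4 * 4 ^ i"
  proof -
    have "n < 2 ^ n" by (rule less_exp)
    also have "\<dots> \<le> 4 ^ n" by (intro power_mono) auto
    finally have "n \<le> 4 * 4 ^ n" by simp
    then show ?thesis using that exists_least_iff[of "\<lambda>L. n \<le> 4 * 4 ^ L"] by blast
  qed
  have "{..<n} \<inter> (\<Union>l. block l) \<subseteq> (\<Union>l<L. block l)"
  proof
    fix j assume "j \<in> {..<n} \<inter> (\<Union>l. block l)"
    then obtain l where l: "j < n" "j \<in> block l" by auto
    then have "4 * 4 ^ l \<le> j" by (simp add: block_def)
    with l L(1) have "4 * 4 ^ l < 4 * (4 ^ L :: nat)" by linarith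
    then have "l < L" by simp
    with l show "j \<in> (\<Union>l<L. block l)" by auto
  qed
  then have "card ({..<n} \<inter> (\<Union>l. block l)) \<le> card (\<Union>l<L. block l)"
    by (intro card_mono) (auto simp: block_def)
  also have "\<dots> \<le> (\<Sum>l<L. card (block l))" by (rule card_UN_le) simp
  also have "\<dots> = (\<Sum>l<L. 4 ^ l)" by (simp add: block_def)
  finally have "card ({..<n} \<inter> (\<Union>l. block l)) \<le> (\<Sum>l<L. 4 ^ l)" .
  moreover have "3 * (\<Sum>l<L. 4 ^ l) < (4 ^ L :: nat)" by (induction L) auto
  moreover have "4 ^ L \<le> n \<or> L = 0"
    using L(2)[of "L - 1"] by (cases L) auto
  ultimately have "2 * card ({..<n} \<inter> (\<Union>l. block l)) \<le> n"
    by auto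
  moreover have "card ({..<n} - (\<Union>l. block l)) = n - card ({..<n} \<inter> (\<Union>l. block l))"
    by (simp add: card_Diff_subset_Int)
  ultimately show ?thesis by simp
qed

lemma hausdorff_dim_ge_half:
  assumes "\<And>b. abs_circle (bin (mask (\<Union>l. block l) b)) \<in> A"
  shows "ereal (1/2) \<le> hausdorff_dim A"
proof (rule hausdorff_dim_mass_distribution)
  let ?X = "\<lambda>b. abs_circle (bin (mask (\<Union>l. block l) b))"
  show "prob_space coins" by (rule coins.prob_space_axioms)
  show "?X b \<in> A" for b by (rule assms)
  have [measurable]: "(\<lambda>b. bin (mask (\<Union>l. block l) b)) \<in> borel_measurable coins"
    by (intro borel_measurable_bin) measurable
  show "{b \<in> space coins. dist (?X b) y \<le> r} \<in> sets coins" for y r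
  proof -
    have [measurable]: "(\<lambda>x. dist x y) \<in> borel_measurable (borel :: circle measure)"
      by (intro borel_measurable_continuous_onI continuous_intros)
    show ?thesis by measurable
  qed
  show "measure coins {b \<in> space coins. dist (?X b) y \<le> r} \<le> 24 * r powr (1/2)"
    if r: "0 < r" "r \<le> 1" for y r
  proof -
    \<comment> \<open>The dyadic scale of \<open>r\<close>:
      \<open>1 / 2 ^ (n + 1) < r <= 1 / 2 ^ n\<close>.\<close>
    define n where "n = nat \<lfloor>log 2 (1 / r)\<rfloor>"
    have "0 \<le> log 2 (1 / r)" using r by simp
    then have n: "n \<le> log 2 (1 / r)" "log 2 (1 / r) < n + 1"
      unfolding n_def by linarith+
    have "2 ^ n = 2 powr n" by (simp add: powr_realpow)
    also have "\<dots> \<le> 2 powr log 2 (1 / r)" using n by (intro powr_mono) auto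
    also have "\<dots> = 1 / r" using r by simp
    finally have "r \<le> 1 / 2 ^ n" using r by (simp add: field_simps)
    have "1 / r = 2 powr log 2 (1 / r)" using r by simp
    also have "\<dots> \<le> 2 powr (n + 1)" using n by (intro powr_mono) auto
    also have "\<dots> = 2 * 2 ^ n" by (simp add: powr_realpow powr_add)
    \<comment> \<open>The factor 4, rather than the sharper 2, gives a rational constant once the
      square root is taken.\<close>
    finally have "(1/2) ^ n \<le> 4 * r" using r by (simp add: field_simps)
    have "((1/2) ^ card ({..<n} - (\<Union>l. block l)))\<^sup>2 \<le> (1/2 :: real) ^ n"
      unfolding power_mult[symmetric] using card_outside_blocks[of n]
      by (intro power_decreasing) auto
    also have "\<dots> \<le> 4 * r" by fact
    finally have "(1/2) ^ card ({..<n} - (\<Union>l. block l)) \<le> sqrt (4 * r)"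
      by (rule real_le_rsqrt)
    also have "\<dots> = 2 * r powr (1/2)"
      using r by (simp add: real_sqrt_mult powr_half_sqrt)
    finally have le: "(1/2) ^ card ({..<n} - (\<Union>l. block l)) \<le> 2 * r powr (1/2)" .
    have "measure coins {b \<in> space coins. dist (?X b) y \<le> r} \<le> measure coins {b. dist (?X b) y \<le> 1 / 2 ^ n}"
    proof (rule coins.finite_measure_mono)
      have [measurable]: "(\<lambda>x. dist x y) \<in> borel_measurable (borel :: circle measure)"
        by (intro borel_measurable_continuous_onI continuous_intros)
      have "{b \<in> space coins. dist (?X b) y \<le> 1 / 2 ^ n} \<in> sets coins" by measurable
      then show "{b. dist (?X b) y \<le> 1 / 2 ^ n} \<in> sets coins" by simp
    qed (use \<open>r \<le> 1 / 2 ^ n\<close> in auto)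
    also have "\<dots> \<le> 12 * (1/2) ^ card ({..<n} - (\<Union>l. block l))"
      by (rule prob_bin_mask_near)
    also have "\<dots> \<le> 24 * r powr (1/2)" using le by simp
    finally show ?thesis .
  qed
qed simp

section \<open>A Rajchman measure\<close>

text \<open>Telescoping by \<open>(1 + w) * (1 - w) = 1 - w ^ 2\<close>, where squaring
  \<open>w\<close> passes from one digit to the preceding one.\<close>

lemma prod_one_plus_char:
  assumes "a \<le> b"
  shows "(\<Prod>j\<in>{a..<b}. 1 + e (x / 2 ^ Suc j)) * (1 - e (x / 2 ^ b)) = 1 - e (x / 2 ^ a)"
  using assms
proof (induction b rule: dec_induct)
  case (step b)
  have "e (x / 2 ^ b) = e (x / 2 ^ Suc b) * e (x / 2 ^ Suc b)"
    by (simp add: cis_mult field_simps)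
  then have "(1 + e (x / 2 ^ Suc b)) * (1 - e (x / 2 ^ Suc b)) = 1 - e (x / 2 ^ b)"
    by (simp add: algebra_simps)
  with step show ?case by (simp add: mult.assoc)
qed simp

text \<open>With \<open>x / 2 ^ b\<close> between 1/4 and 1/2 in absolute value,
  \<open>1 - e (x / 2 ^ b)\<close> has real part at least 1. Dividing the telescoped identity by it
  is harmless, and the halves supply the power of 2.\<close>

lemma norm_prod_one_plus_char_le:
  assumes "a \<le> b" "1/4 \<le> \<bar>x\<bar> / 2 ^ b" "\<bar>x\<bar> / 2 ^ b \<le> 1/2"
  shows "norm (\<Prod>j\<in>{a..<b}. (1 + e (x / 2 ^ Suc j)) / 2) \<le> 2 / 2 ^ (b - a)"
proof -
  have "cos (2 * pi * (x / 2 ^ b)) = cos (2 * pi * (\<bar>x\<bar> / 2 ^ b))"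
    by (cases "x \<ge> 0") auto
  also have "\<dots> \<le> cos (2 * pi * (1/4))"
    using mult_left_mono[OF assms(3), of "2 * pi"] assms(2)
    by (intro cos_monotone_0_pi_le mult_left_mono) auto
  also have "2 * pi * (1/4) = pi / 2" by simp
  finally have "1 \<le> Re (1 - e (x / 2 ^ b))" by simp
  then have "1 \<le> norm (1 - e (x / 2 ^ b))"
    using complex_Re_le_cmod order_trans by blast
  then have "norm (\<Prod>j\<in>{a..<b}. 1 + e (x / 2 ^ Suc j))
      \<le> norm (\<Prod>j\<in>{a..<b}. 1 + e (x / 2 ^ Suc j)) * norm (1 - e (x / 2 ^ b))"
    by (simp add: mult_le_cancel_left1)
  also have "\<dots> = norm (1 - e (x / 2 ^ a))"
    using prod_one_plus_char[OF assms(1), of x] by (simp only: norm_mult[symmetric])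
  also have "\<dots> \<le> 2" using norm_triangle_ineq4[of 1 "e (x / 2 ^ a)"] by simp
  finally show ?thesis
    by (simp add: prod_dividef norm_divide norm_power divide_right_mono)
qed

lemma integral_coin: "(LINT v|coin. g v) = (g False + g True) / 2" for g :: "bool \<Rightarrow> complex"
proof -
  have "(LINT v|coin. g v) = (\<Sum>v\<in>UNIV. pmf (pmf_of_set UNIV) v *\<^sub>R g v)"
    by (rule integral_measure_pmf) auto
  also have "\<dots> = (\<Sum>v\<in>UNIV. g v / 2)"
    by (simp add: scaleR_conv_of_real)
  finally show ?thesis by (simp add: UNIV_bool add_divide_distrib)
qed

text \<open>The character turns the digit sum into a product of functions of independent coins; an
  erased digit contributes the factor 1.\<close>

lemma integral_char_val_mask:
  "(LINT b|coins. e (x * (val N (mask Z b) / 2 ^ N)))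
     = (\<Prod>j<N. if j \<in> Z then 1 else (1 + e (x / 2 ^ Suc j)) / 2)"
proof -
  define g where "g j v = e (x * (of_bool (v \<and> j \<notin> Z) / 2 ^ Suc j))" for j v
  have eq: "e (x * (val N (mask Z b) / 2 ^ N)) = (\<Prod>j<N. g j (restrict b {..<N} j))" for b
  proof -
    have "e (x * (val N (mask Z b) / 2 ^ N)) = e (\<Sum>j<N. x * (of_bool (b j \<and> j \<notin> Z) / 2 ^ Suc j))"
      unfolding bin_partial_sum[symmetric] mask_def by (simp only: sum_distrib_left)
    also have "\<dots> = (\<Prod>j<N. e (x * (of_bool (b j \<and> j \<notin> Z) / 2 ^ Suc j)))"
      by (simp add: cis_conv_exp sum_distrib_left sum_distrib_right flip: exp_sum)
    finally show ?thesis by (simp add: g_def)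
  qed
  have g_meas: "(\<lambda>\<omega>. \<Prod>j<N. g j (\<omega> j)) \<in> borel_measurable (PiM {..<N} (\<lambda>_. coin))"
    by (intro borel_measurable_prod measurable_compose[OF measurable_component_singleton]) auto
  have "(LINT b|coins. e (x * (val N (mask Z b) / 2 ^ N)))
      = (LINT b|coins. (\<Prod>j<N. g j (restrict b {..<N} j)))"
    by (simp only: eq)
  also have "\<dots> = (LINT \<omega>|distr coins (PiM {..<N} (\<lambda>_. coin)) (\<lambda>b. restrict b {..<N}). (\<Prod>j<N. g j (\<omega> j)))"
    unfolding coins_def using g_meas
    by (subst integral_distr) (auto intro: measurable_restrict_subset)
  \<comment> \<open>Projecting to the first \<open>N\<close> coins gives a finite product, for which
    integrals of products factorise.\<close>
  also have "distr coins (PiM {..<N} (\<lambda>_. coin)) (\<lambda>b. restrict b {..<N}) = PiM {..<N} (\<lambda>_. coin)"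
    unfolding coins_def by (rule coin_product.distr_PiM_restrict_finite) auto
  also have "(LINT \<omega>|PiM {..<N} (\<lambda>_. coin). (\<Prod>j<N. g j (\<omega> j))) = (\<Prod>j<N. LINT v|coin. g j v)"
    by (rule coin_product.product_integral_prod) (auto intro: integrable_measure_pmf_finite)
  also have "\<dots> = (\<Prod>j<N. if j \<in> Z then 1 else (1 + e (x / 2 ^ Suc j)) / 2)"
    by (intro prod.cong refl) (simp add: integral_coin g_def)
  finally show ?thesis .
qed

lemma norm_one_plus_cis_half: "norm ((1 + cis t) / 2) \<le> 1"
  using norm_triangle_ineq[of 1 "cis t"] by (simp add: norm_divide)

lemma borel_measurable_cis [measurable]: "cis \<in> borel_measurable borel"
  by (intro borel_measurable_continuous_onI continuous_intros)

text \<open>In the product for the truncation to \<open>N\<close> digits, factors outside the free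
  window \<open>{a..<b}\<close> have norm at most 1 and the window is handled by telescoping.
  Dominated convergence then lets \<open>N\<close> tend to infinity.\<close>

lemma norm_integral_char_bin_le:
  assumes "a \<le> b" "1/4 \<le> \<bar>x\<bar> / 2 ^ b" "\<bar>x\<bar> / 2 ^ b \<le> 1/2" "{a..<b} \<inter> Z = {}"
  shows "norm (LINT d|coins. e (x * bin (mask Z d))) \<le> 2 / 2 ^ (b - a)"
proof -
  let ?f = "\<lambda>j. if j \<in> Z then 1 else (1 + e (x / 2 ^ Suc j)) / 2"
  have [measurable]: "(\<lambda>d. bin (mask Z d)) \<in> borel_measurable coins"
    by (intro borel_measurable_bin) measurable
  have [measurable]: "(\<lambda>d. real (val N (mask Z d))) \<in> borel_measurable coins" for N
    by (intro borel_measurable_val) measurable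
  have "(\<lambda>N. LINT d|coins. e (x * (val N (mask Z d) / 2 ^ N))) \<longlonglongrightarrow> (LINT d|coins. e (x * bin (mask Z d)))"
  proof (rule integral_dominated_convergence[where w = "\<lambda>_. 1"])
    have "(\<lambda>N. val N (mask Z d) / 2 ^ N) \<longlonglongrightarrow> bin (mask Z d)" for d
      unfolding bin_partial_sum[symmetric] bin_def by (rule summable_LIMSEQ[OF bin_summable])
    then show "AE d in coins. (\<lambda>N. e (x * (val N (mask Z d) / 2 ^ N))) \<longlonglongrightarrow> e (x * bin (mask Z d))"
      by (intro AE_I2 tendsto_intros)
  qed auto
  then show ?thesis
  proof (rule LIMSEQ_le_const2[OF tendsto_norm], intro exI allI impI)
    fix N assume "b \<le> N"
    have "norm (LINT d|coins. e (x * (val N (mask Z d) / 2 ^ N))) = (\<Prod>j<N. norm (?f j))"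
      by (simp only: integral_char_val_mask prod_norm)
    also have "\<dots> = (\<Prod>j\<in>{..<N} - {a..<b}. norm (?f j)) * (\<Prod>j\<in>{a..<b}. norm (?f j))"
      using \<open>b \<le> N\<close> by (intro prod.subset_diff) auto
    also have "\<dots> \<le> 1 * (\<Prod>j\<in>{a..<b}. norm (?f j))"
      using norm_one_plus_cis_half by (intro mult_right_mono prod_le_1 prod_nonneg) auto
    also have "\<dots> = norm (\<Prod>j\<in>{a..<b}. (1 + e (x / 2 ^ Suc j)) / 2)"
      unfolding prod_norm mult_1
      using assms(4) by (intro arg_cong[of _ _ norm] prod.cong) auto
    also have "\<dots> \<le> 2 / 2 ^ (b - a)"
      using assms by (intro norm_prod_one_plus_char_le)
    finally show "norm (LINT d|coins. e (x * (val N (mask Z d) / 2 ^ N))) \<le> 2 / 2 ^ (b - a)" .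
  qed
qed

text \<open>
  A typewriter sequence: in each range \<open>2 ^ i \<le> l < 2 ^ (i + 1)\<close> exactly one index is chosen, uniformly.
  Choices for different \<open>i\<close> are dependent, which does no harm.
\<close>

definition selected :: "(nat \<Rightarrow> bool) \<Rightarrow> nat set" where
  "selected c = range (\<lambda>i. 2 ^ i + val i c)"

lemma infinite_selected: "infinite (selected c)"
  unfolding infinite_nat_iff_unbounded
proof
  fix m :: nat
  have "m < 2 ^ m + val m c" by (intro trans_less_add1 less_exp)
  then show "\<exists>n>m. n \<in> selected c" by (auto simp: selected_def)
qed

lemma pred_selected [measurable]: "Measurable.pred coins (\<lambda>c. l \<in> selected c)"
proof -
  have [measurable]: "Measurable.pred coins (\<lambda>c. val i c = k)" for i k
    by (rule pred_val) measurable
  have "l = 2 ^ i + val i c \<longleftrightarrow> 2 ^ i \<le> l \<and> val i c = l - 2 ^ i" for i c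
    by auto
  then have "l \<in> selected c \<longleftrightarrow> (\<exists>i. 2 ^ i \<le> l \<and> val i c = l - 2 ^ i)" for c
    by (simp add: selected_def image_iff)
  then show ?thesis by simp
qed

text \<open>Only the index \<open>i\<close> with \<open>2 ^ i <= l < 2 ^ (i + 1)\<close> can produce
  \<open>l\<close>, and it does so with probability at most \<open>1 / 2 ^ i\<close>.\<close>

lemma prob_selected_le:
  assumes "0 < l"
  shows "measure coins {c. l \<in> selected c} \<le> 2 / l"
proof -
  obtain i where i: "2 ^ i \<le> l" "l < 2 ^ Suc i"
    using ex_power_ivl1[of 2 l] assms by auto
  have "val i c = l - 2 ^ i" if "l \<in> selected c" for c
  proof -
    from that obtain k where k: "l = 2 ^ k + val k c" by (auto simp: selected_def)
    then have "2 ^ k \<le> l" "l < 2 ^ Suc k" using val_less[of k c] by auto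
    then have "2 ^ k < (2 ^ Suc i :: nat)" "2 ^ i < (2 ^ Suc k :: nat)" using i by linarith+
    then have "k < Suc i" "i < Suc k" by (simp_all only: power_strict_increasing_iff)
    then have "k = i" by simp
    then show ?thesis using k by simp
  qed
  \<comment> \<open>\<open>mask {}\<close> erases nothing; it brings the event into the form of
    \<open>prob_val_mask\<close>.\<close>
  then have "measure coins {c. l \<in> selected c} \<le> measure coins {c. val i (mask {} c) = l - 2 ^ i}"
    using pred_val[where M = coins and D = "mask {}" and n = i and k = "l - 2 ^ i", OF pred_mask]
    by (intro coins.finite_measure_mono) (auto simp: pred_def mask_def)
  also have "\<dots> \<le> (1/2) ^ i" using prob_val_mask[of i "{}" "l - 2 ^ i"] by simp
  also have "\<dots> \<le> 2 / l"
  proof -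
    have "real l \<le> 2 * 2 ^ i" using i(2) by (metis less_imp_le of_nat_le_iff of_nat_numeral of_nat_power power_Suc)
    then show ?thesis using assms by (simp add: field_simps)
  qed
  finally show ?thesis .
qed

section \<open>The random measure and the decay of its Fourier coefficients\<close>

text \<open>Two independent coin sequences: \<open>c\<close> decides which blocks are erased,
  \<open>d\<close> supplies the digits elsewhere.\<close>

definition random_digits :: "(nat \<Rightarrow> bool) \<Rightarrow> (nat \<Rightarrow> bool) \<Rightarrow> nat \<Rightarrow> bool" where
  "random_digits c d = mask (\<Union>l\<in>selected c. block l) d"

interpretation coins2: pair_prob_space coins coins ..

lemma borel_measurable_bin_random_digits [measurable]:
  "(\<lambda>\<omega>. bin (random_digits (fst \<omega>) (snd \<omega>))) \<in> borel_measurable (coins \<Otimes>\<^sub>M coins)"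
proof -
  have "Measurable.pred (coins \<Otimes>\<^sub>M coins) (\<lambda>\<omega>. random_digits (fst \<omega>) (snd \<omega>) j)" for j
  proof -
    have "random_digits (fst \<omega>) (snd \<omega>) j \<longleftrightarrow> snd \<omega> j \<and> (\<forall>l. j \<in> block l \<longrightarrow> l \<notin> selected (fst \<omega>))" for \<omega>
      by (auto simp: random_digits_def mask_def)
    then show ?thesis by simp
  qed
  then show ?thesis by (rule borel_measurable_bin)
qed

definition random_measure :: "circle measure" where
  "random_measure = distr (coins \<Otimes>\<^sub>M coins) borel (\<lambda>\<omega>. abs_circle (bin (random_digits (fst \<omega>) (snd \<omega>))))"

text \<open>The topology on \<open>circle\<close> comes from the metric, so continuity is
  transferred from the real line by lifting nearby points to nearby representatives.\<close>

lemma continuous_on_circle: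
  fixes f :: "circle \<Rightarrow> 'a :: metric_space"
  assumes "continuous_on UNIV (\<lambda>x. f (abs_circle x))"
  shows "continuous_on UNIV f"
proof (rule continuous_onI)
  fix y and \<epsilon> :: real assume "0 < \<epsilon>"
  obtain u where u: "y = abs_circle u" by (induction y rule: circle.abs_induct) blast
  from assms \<open>0 < \<epsilon>\<close> obtain \<delta> where \<delta>: "\<delta> > 0"
    "\<And>x. dist x u < \<delta> \<Longrightarrow> dist (f (abs_circle x)) (f (abs_circle u)) < \<epsilon>"
    unfolding continuous_on_iff by (metis UNIV_I)
  have "dist (f z) (f y) \<le> \<epsilon>" if "dist z y < \<delta>" for z
  proof -
    obtain v where v: "z = abs_circle v" by (induction z rule: circle.abs_induct) blast
    \<comment> \<open>The representative of \<open>z\<close> nearest to \<open>u\<close>; its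
      distance to \<open>u\<close> is exactly \<open>dist z y\<close>.\<close>
    define v' where "v' = v - of_int (round (v - u))"
    have "abs_circle v' = z" unfolding v v'_def by (simp add: circle.abs_eq_iff)
    moreover have "dist v' u < \<delta>"
      using that by (simp add: u v v'_def dist_abs_circle dist_real_def algebra_simps)
    ultimately show ?thesis using \<delta>(2)[of v'] by (simp add: u)
  qed
  with \<open>\<delta> > 0\<close> show "\<exists>d>0. \<forall>z\<in>UNIV. dist z y < d \<longrightarrow> dist (f z) (f y) \<le> \<epsilon>" by blast
qed

lemma continuous_circle_char: "continuous_on UNIV (circle_char n)"
  by (intro continuous_on_circle) (auto simp: circle_char_abs intro!: continuous_intros)

lemma measurable_circle_char [measurable]: "circle_char n \<in> borel_measurable borel"
  using continuous_circle_char by (rule borel_measurable_continuous_onI)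

text \<open>Fubini, with the digits integrated first, so that the inner integral concerns a fixed
  set of erased blocks.\<close>

lemma fourier_coeff_random_measure:
  "fourier_coeff random_measure n = (LINT c|coins. LINT d|coins. e (- of_int n * bin (random_digits c d)))"
  (is ?eq)
  and integrable_random_measure: "integrable coins (\<lambda>c. LINT d|coins. e (- of_int n * bin (random_digits c d)))"
proof -
  let ?f = "\<lambda>\<omega>. e (- of_int n * bin (random_digits (fst \<omega>) (snd \<omega>)))"
  have [measurable]: "?f \<in> borel_measurable (coins \<Otimes>\<^sub>M coins)"
    by measurable
  have int: "integrable (coins \<Otimes>\<^sub>M coins) ?f"
    by (rule coins2.integrable_const_bound[where B = 1]) auto
  have "fourier_coeff random_measure n = (LINT \<omega>|(coins \<Otimes>\<^sub>M coins). ?f \<omega>)"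
    unfolding fourier_coeff_def random_measure_def
    by (subst integral_distr) (auto simp: circle_char_abs intro!: Bochner_Integration.integral_cong)
  also have "\<dots> = (LINT c|coins. LINT d|coins. e (- of_int n * bin (random_digits c d)))"
    using coins2.integral_fst'[OF int] by simp
  finally show ?eq .
  show "integrable coins (\<lambda>c. LINT d|coins. e (- of_int n * bin (random_digits c d)))"
    using coins2.integrable_fst'[OF int] by simp
qed

text \<open>Unless block \<open>l\<close> is selected, the \<open>4 ^ l\<close> digits just before
  position \<open>b\<close> are free and the inner integral is tiny. Selection has probability at
  most \<open>2 / l\<close>, and then the trivial bound 1 is used.\<close>

lemma norm_fourier_coeff_random_measure_le:
  assumes b: "4 * 4 ^ l \<le> b" "b < 16 * 4 ^ l" "0 < l"
    and n: "1/4 \<le> \<bar>real_of_int n\<bar> / 2 ^ b" "\<bar>real_of_int n\<bar> / 2 ^ b \<le> 1/2"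
  shows "norm (fourier_coeff random_measure n) \<le> 4 / l"
proof -
  define q :: nat where "q = 4 ^ l"
  let ?I = "\<lambda>c. LINT d|coins. e (- of_int n * bin (random_digits c d))"
  have small: "norm (?I c) \<le> 2 / 2 ^ q" if "l \<notin> selected c" for c
  proof -
    \<comment> \<open>Blocks before \<open>l\<close> end by \<open>2 * q\<close>, while the window
      starts at \<open>3 * q\<close> or later; blocks after \<open>l\<close> start at
      \<open>16 * q\<close>, beyond \<open>b\<close>.\<close>
    have "{b - q..<b} \<inter> block l' = {}" if "l' \<noteq> l" for l'
    proof (cases "l' < l")
      case True
      then obtain k where "l = Suc (l' + k)" using less_imp_Suc_add by blast
      then have "4 * 4 ^ l' * 4 ^ k = q" by (simp add: q_def power_add)
      moreover have "4 * 4 ^ l' * 1 \<le> 4 * 4 ^ l' * (4 ^ k :: nat)" by (intro mult_left_mono) auto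
      ultimately have "4 * 4 ^ l' \<le> q" by simp
      then show ?thesis using b(1) by (auto simp: block_def q_def)
    next
      case False
      then have "4 ^ Suc l \<le> (4 ^ l' :: nat)" using that by (intro power_increasing) auto
      then show ?thesis using b(2) by (auto simp: block_def)
    qed
    then have "{b - q..<b} \<inter> block l' = {}" if "l' \<in> selected c" for l'
      using that \<open>l \<notin> selected c\<close> by metis
    then have "{b - q..<b} \<inter> (\<Union>l\<in>selected c. block l) = {}" by blast
    then have "norm (?I c) \<le> 2 / 2 ^ (b - (b - q))"
      unfolding random_digits_def using n by (intro norm_integral_char_bin_le) auto
    also have "b - (b - q) = q" using b(1) by (simp add: q_def)
    finally show ?thesis .
  qed
  have le_1: "norm (?I c) \<le> 1" for c
  proof -
    have "norm (?I c) \<le> (LINT d|coins. norm (e (- of_int n * bin (random_digits c d))))"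
      by (rule integral_norm_bound)
    then show ?thesis by simp
  qed
  have bound: "norm (?I c) \<le> indicator {c. l \<in> selected c} c + 2 / 2 ^ q" for c
    using small[of c] le_1[of c] by (cases "l \<in> selected c") (auto intro: order_trans)
  have sel: "{c. l \<in> selected c} \<in> sets coins"
    using pred_selected[of l] by (simp add: pred_def)
  have "norm (fourier_coeff random_measure n) \<le> (LINT c|coins. norm (?I c))"
    unfolding fourier_coeff_random_measure by (rule integral_norm_bound)
  also have "\<dots> \<le> (LINT c|coins. indicator {c. l \<in> selected c} c + 2 / 2 ^ q)"
    using sel bound by (intro integral_mono integrable_norm integrable_random_measure) 
      (auto intro!: integrable_real_indicator simp: coins.emeasure_eq_measure)
  also have "\<dots> = measure coins {c. l \<in> selected c} + 2 / 2 ^ q"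
    using sel by (subst Bochner_Integration.integral_add)
      (auto intro!: integrable_real_indicator simp: coins.emeasure_eq_measure)
  also have "\<dots> \<le> 2 / l + 2 / l"
  proof (intro add_mono divide_left_mono prob_selected_le)
    have "l < 2 ^ l" by (rule less_exp)
    also have "(2 :: nat) ^ l \<le> q" unfolding q_def by (intro power_mono) auto
    also have "q < 2 ^ q" by (rule less_exp)
    finally have "real l \<le> real (2 ^ q)" by (intro of_nat_mono) simp
    then show "real l \<le> 2 ^ q" by simp
  qed (use b(3) in auto)
  finally show ?thesis by simp
qed

lemma rajchman_random_measure: "rajchman_measure random_measure"
  unfolding rajchman_measure_def
proof (intro conjI)
  have "prob_space random_measure"
    unfolding random_measure_def by (intro coins2.prob_space_distr) measurable
  then show "finite_measure random_measure" by (simp add: prob_space.finite_measure)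
  show "sets random_measure = sets borel" by (simp add: random_measure_def)
  show "(fourier_coeff random_measure \<longlongrightarrow> 0) (filtercomap abs at_top)"
  proof (rule tendstoI)
    fix \<epsilon> :: real assume "0 < \<epsilon>"
    obtain L :: nat where L: "4 / \<epsilon> < L" using reals_Archimedean2 by blast
    have "dist (fourier_coeff random_measure n) 0 < \<epsilon>" if n: "2 ^ (16 * 4 ^ L) \<le> \<bar>n\<bar>" for n
    proof -
      have "0 < \<bar>n\<bar>" using n by (rule less_le_trans[rotated]) simp
      then have "\<exists>p. 2 ^ p \<le> nat \<bar>n\<bar> \<and> nat \<bar>n\<bar> < 2 ^ (p + 1)"
        by (intro ex_power_ivl1) auto
      \<comment> \<open>Taking \<open>b = p + 2\<close> places \<open>|n| / 2 ^ b\<close> between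
        1/4 and 1/2.\<close>
      then obtain p where p: "2 ^ p \<le> nat \<bar>n\<bar>" "nat \<bar>n\<bar> < 2 ^ Suc p"
        unfolding Suc_eq_plus1 by blast
      have p': "2 ^ p \<le> \<bar>real_of_int n\<bar>" "\<bar>real_of_int n\<bar> \<le> 2 * 2 ^ p"
      proof -
        have "real (2 ^ p) \<le> real (nat \<bar>n\<bar>)" "real (nat \<bar>n\<bar>) \<le> real (2 ^ Suc p)"
          using p by (intro of_nat_mono; simp)+
        then show "2 ^ p \<le> \<bar>real_of_int n\<bar>" "\<bar>real_of_int n\<bar> \<le> 2 * 2 ^ p" by simp_all
      qed
      have "2 ^ (16 * 4 ^ L) \<le> nat \<bar>n\<bar>" using n by (simp add: le_nat_iff)
      then have "2 ^ (16 * 4 ^ L) < (2 ^ Suc p :: nat)" using p(2) by linarith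
      then have pL: "16 * 4 ^ L \<le> p" by (simp only: power_strict_increasing_iff)
      moreover have "1 \<le> (4 :: nat) ^ L" by simp
      ultimately have "1 \<le> (p + 2) div 4" by linarith
      \<comment> \<open>Dividing by 4 turns the requirement
        \<open>4 * 4 ^ l <= p + 2 < 16 * 4 ^ l\<close> into a bracketing by consecutive powers of
        4.\<close>
      then obtain l where l: "4 ^ l \<le> (p + 2) div 4" "(p + 2) div 4 < 4 ^ Suc l"
        using ex_power_ivl1[of 4 "(p + 2) div 4"] by auto
      have "4 ^ Suc L \<le> (p + 2) div 4" using pL by simp
      also note l(2)
      finally have "L < l" using power_less_imp_less_exp[of "4 :: nat" "Suc L" "Suc l"] by simp
      have "norm (fourier_coeff random_measure n) \<le> 4 / l"
      proof (rule norm_fourier_coeff_random_measure_le)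
        show "4 * 4 ^ l \<le> p + 2" "p + 2 < 16 * 4 ^ l" using l by auto
        show "0 < l" using \<open>L < l\<close> by simp
        show "1/4 \<le> \<bar>real_of_int n\<bar> / 2 ^ (p + 2)" "\<bar>real_of_int n\<bar> / 2 ^ (p + 2) \<le> 1/2"
          using p' by (simp_all add: field_simps)
      qed
      also have "4 / l < \<epsilon>"
        using L \<open>L < l\<close> \<open>0 < \<epsilon>\<close> by (auto simp: field_simps intro: less_trans)
      finally show ?thesis by simp
    qed
    then show "\<forall>\<^sub>F n in filtercomap abs at_top. dist (fourier_coeff random_measure n) 0 < \<epsilon>"
      by (auto simp: eventually_filtercomap_at_top_linorder)
  qed
qed

section \<open>Measurability of the exceptional set and the conclusion\<close>

lemma continuous_circle_mult: "continuous_on UNIV (circle_mult m)"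
  by (intro continuous_on_circle)
    (auto simp: circle_mult_abs intro!: continuous_on_compose2[OF continuous_abs_circle] continuous_intros)

text \<open>Equidistribution is a countable conjunction over \<open>h\<close> of convergence
  statements for measurable averages.\<close>

lemma sets_W: "W S \<in> sets borel"
proof -
  have [measurable]: "circle_mult m \<in> borel \<rightarrow>\<^sub>M borel" for m
    using continuous_circle_mult by (rule borel_measurable_continuous_onI)
  have "Measurable.pred borel (\<lambda>x. \<not> equidistributed (\<lambda>n. circle_mult (increasing_enum S n) x))"
    unfolding equidistributed_def by measurable
  then show ?thesis by (simp add: W_def pred_def)
qed

theorem theorem1p2:
  fixes S :: "nat set"
  assumes "S = {2 ^ j * 3 ^ k | j k :: nat. True}"
  shows "hausdorff_dim (W S) \<ge> ereal 0.451621 \<and>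
    (\<exists>\<mu>. prob_space \<mu> \<and> rajchman_measure \<mu> \<and> emeasure \<mu> (W S) = 1)"
proof
  have "abs_circle (bin (mask (\<Union>l. block l) b)) \<in> W S" for b
    by (rule not_equidistributed_zero_blocks[OF assms infinite_UNIV_nat]) (auto simp: mask_def)
  then have "ereal (1/2) \<le> hausdorff_dim (W S)" by (rule hausdorff_dim_ge_half)
  then show "hausdorff_dim (W S) \<ge> ereal 0.451621" by (rule order_trans[rotated]) simp
next
  \<comment> \<open>Infinitely many blocks are selected for every \<open>c\<close>, so membership
    holds at every outcome and not just almost surely.\<close>
  have in_W: "abs_circle (bin (random_digits c d)) \<in> W S" for c d
    by (rule not_equidistributed_zero_blocks[OF assms infinite_selected[of c]])
      (auto simp: random_digits_def mask_def)
  have "prob_space random_measure"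
    unfolding random_measure_def by (intro coins2.prob_space_distr) measurable
  moreover have "emeasure random_measure (W S) = 1"
    unfolding random_measure_def using sets_W in_W
    by (subst emeasure_distr) (auto simp: vimage_def coins2.emeasure_space_1)
  ultimately show "\<exists>\<mu>. prob_space \<mu> \<and> rajchman_measure \<mu> \<and> emeasure \<mu> (W S) = 1"
    using rajchman_random_measure by blast
qed

end
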